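(* Let $q,m,n$ be nonnegative integers with $m+n>0$. Then, as polynomials in $x$, $$\sum_{j=0}^{m+q}\binom{m+q}{j}(n+q+j)B_{n+q+j-1}(x)=-(-1)^{m+n}\sum_{k=0}^{n+q}\binom{n+q}{k}(m+q+k)B_{m+q+k-1}(-x).$$
   Context: The Bernoulli polynomials $B_n(x)$ are defined by $\frac{te^{xt}}{e^t-1}=\sum_{n\ge0}B_n(x)\frac{t^n}{n!}$. A summand whose numerical coefficient $(n+q+j)$ or $(m+q+k)$ equals $0$ (so that the index of $B$ would be $-1$) is interpreted as $0$. *)

theory Defs
  imports "HOL-Computational_Algebra.Computational_Algebra"
begin

text \<open>
  The generating function \<open>t e\<^sup>x\<^sup>t / (e\<^sup>t - 1)\<close> is a power series in \<open>t\<close> whose coefficients are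
  polynomials in \<open>x\<close>.  Dividing by \<open>e\<^sup>t - 1\<close> is done for power series over the field, where
  \<open>fps_X / (fps_exp 1 - 1)\<close> is an exact division (both series have subdegree 1); the quotient is
  then embedded coefficientwise as constant polynomials.

  The index of \<open>bernpoly\<close> is a natural number, so \<open>of_nat N * bernpoly (N - 1)\<close> is \<open>0\<close> for
  \<open>N = 0\<close>: this is the convention that a summand with coefficient 0 and index -1 vanishes.
\<close>

definition exp_xt :: "'a::field_char_0 poly fps" where
  "exp_xt = Abs_fps (\<lambda>n. monom (1 / fact n) n)"

definition bernpoly_gf :: "'a::field_char_0 poly fps" where
  "bernpoly_gf = Abs_fps (\<lambda>n. [: fps_nth (fps_X / (fps_exp 1 - 1)) n :]) * exp_xt"

definition bernpoly :: "nat \<Rightarrow> 'a::field_char_0 poly" where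
  "bernpoly n = smult (fact n) (fps_nth bernpoly_gf n)"

text \<open>
  The values of these polynomials satisfy the defining identity
  \<open>t e\<^sup>x\<^sup>t / (e\<^sup>t - 1) = (\<Sum>n. B\<^sub>n(x) t\<^sup>n / n!)\<close> at every point \<open>x\<close> of the field.
\<close>

lemma bernpoly_generating_function:
  fixes x :: "'a::field_char_0"
  shows "fps_X * fps_exp x / (fps_exp 1 - 1) = Abs_fps (\<lambda>n. poly (bernpoly n) x / fact n)"
proof -
  let ?E = "fps_exp (1::'a) - 1"
  have nz: "?E \<noteq> 0"
    by (auto simp: fps_eq_iff intro!: exI[of _ 1])
  have "subdegree ?E = 1"
    by (intro subdegreeI) (auto simp: less_Suc_eq)
  then have dvd: "?E dvd fps_X"
    using nz by (simp add: fps_dvd_iff)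
  have "fps_X * fps_exp x / ?E = fps_X / ?E * fps_exp x"
    using dvd by (simp add: div_mult_swap mult.commute)
  also have "\<dots> = Abs_fps (\<lambda>n. poly (bernpoly n) x / fact n)"
    by (simp add: fps_eq_iff fps_mult_nth bernpoly_def bernpoly_gf_def exp_xt_def
        poly_sum poly_monom)
  finally show ?thesis .
qed

end

theory Submission
  imports Defs
begin

text \<open>
  Put \<open>D n = n B\<^bsub>n-1\<^esub>(x)\<close>, with exponential generating function \<open>t\<^sup>2 e\<^sup>x\<^sup>t / (e\<^sup>t - 1)\<close>.
  Replacing \<open>(t, x)\<close> by \<open>(-t, -x)\<close> multiplies this series by \<open>- e\<^sup>t\<close>, so up to a sign \<open>D(-x)\<close>
  is the binomial transform of \<open>D(x)\<close>.  For any two sequences related by the binomial transform,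
  the sums \<open>S(a, b) = (\<Sum>j. (a choose j) u\<^bsub>b+j\<^esub>)\<close> and \<open>T(a, b) = (\<Sum>k. (b choose k) v\<^bsub>a+k\<^esub>)\<close>
  agree up to \<open>(-1)\<^bsup>a+b\<^esup>\<close>, since \<open>S(a+1, b) = S(a, b) + S(a, b+1)\<close> and
  \<open>T(a, b+1) = T(a, b) + T(a+1, b)\<close> by Pascal's rule.
\<close>

lemma binomial_sum_Suc:
  fixes u :: "nat \<Rightarrow> 'b::comm_ring_1"
  shows "(\<Sum>j=0..Suc a. of_nat (Suc a choose j) * u (b + j))
    = (\<Sum>j=0..a. of_nat (a choose j) * u (b + j))
      + (\<Sum>j=0..a. of_nat (a choose j) * u (Suc b + j))"
proof -
  have "(\<Sum>j=0..Suc a. of_nat (Suc a choose j) * u (b + j))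
      = u b + (\<Sum>j=0..a. of_nat (Suc a choose Suc j) * u (b + Suc j))"
    by (subst sum.atLeast0_atMost_Suc_shift) simp
  also have "\<dots> = (u b + (\<Sum>j=0..a. of_nat (a choose Suc j) * u (b + Suc j)))
      + (\<Sum>j=0..a. of_nat (a choose j) * u (Suc b + j))"
    by (simp add: sum.distrib algebra_simps)
  also have "u b + (\<Sum>j=0..a. of_nat (a choose Suc j) * u (b + Suc j))
      = (\<Sum>j=0..Suc a. of_nat (a choose j) * u (b + j))"
    by (subst sum.atLeast0_atMost_Suc_shift) simp
  also have "\<dots> = (\<Sum>j=0..a. of_nat (a choose j) * u (b + j))"
    by (simp add: binomial_eq_0)
  finally show ?thesis .
qed

lemma binomial_transform_reciprocity:
  fixes u v :: "nat \<Rightarrow> 'b::comm_ring_1"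
  assumes "\<And>n. v n = (-1) ^ n * (\<Sum>k=0..n. of_nat (n choose k) * u k)"
  shows "(\<Sum>j=0..a. of_nat (a choose j) * u (b + j))
    = (-1) ^ (a + b) * (\<Sum>k=0..b. of_nat (b choose k) * v (a + k))"
proof (induction b arbitrary: a)
  case 0
  show ?case
    using assms[of a] by (simp flip: mult.assoc power_mult_distrib)
next
  case (Suc b)
  show ?case
    \<comment> \<open>Here S(a, b+1) = S(a+1, b) - S(a, b). The two induction hypotheses have
      opposite signs, so this difference becomes a sum of T-terms, which is T(a, b+1) up to
      sign.\<close>
    using Suc.IH[of a] Suc.IH[of "Suc a"] binomial_sum_Suc[of a u b] binomial_sum_Suc[of b v a]
    by (simp add: algebra_simps)
qed

text \<open>Composition with \<open>- fps_X\<close> substitutes -t for t, and e^(-t) - 1 = -e^(-t)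
  (e^t - 1): the minus sign cancels that of the numerator, leaving the factor e^t.\<close>

lemma bernpoly_gf_reflect:
  fixes x :: "'a::field_char_0"
  defines "A \<equiv> \<lambda>y::'a. fps_X * fps_exp y / (fps_exp 1 - 1)"
  shows "A (- x) oo (- fps_X) = A x * fps_exp 1"
proof -
  let ?E = "fps_exp (1::'a) - 1"
  have nz: "?E \<noteq> 0"
    by (auto simp: fps_eq_iff intro!: exI[of _ 1])
  have "subdegree ?E = 1"
    by (intro subdegreeI) (auto simp: less_Suc_eq)
  then have "?E dvd fps_X"
    using nz by (simp add: fps_dvd_iff)
  \<comment> \<open>Composition respects products, so the exact quotient is handled through this
    product identity.\<close>
  then have A: "A y * ?E = fps_X * fps_exp y" for y
    by (simp add: A_def)
  have exp_uminus: "fps_exp c oo (- fps_X) = fps_exp (- c)" for c :: 'a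
    by (simp add: fps_eq_iff fps_compose_uminus' power_minus')
  have inv: "fps_exp (1::'a) * fps_exp (- 1) = 1"
    by (simp flip: fps_exp_add_mult)
  have "(A (- x) oo (- fps_X)) * (?E oo (- fps_X)) = (fps_X * fps_exp (- x)) oo (- fps_X)"
    by (simp add: fps_compose_mult_distrib flip: A)
  then have B: "(A (- x) oo (- fps_X)) * (fps_exp (- 1) - 1) = - fps_X * fps_exp x"
    by (simp add: fps_compose_mult_distrib fps_compose_sub_distrib exp_uminus)
  have "(A (- x) oo (- fps_X)) * ?E
      = - ((A (- x) oo (- fps_X)) * (fps_exp (- 1) - 1)) * fps_exp 1"
    by (simp add: algebra_simps inv)
  also have "\<dots> = A x * fps_exp 1 * ?E"
    unfolding B using A[of x] by (simp add: ac_simps)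
  finally show ?thesis
    using nz by simp
qed

lemma bernpoly_reflect:
  fixes n :: nat
  defines "D \<equiv> \<lambda>i. of_nat i * bernpoly (i - 1) :: 'a::field_char_0 poly"
  shows "- pcompose (D n) [:0, -1:] = (-1) ^ n * (\<Sum>k=0..n. of_nat (n choose k) * D k)"
proof -
  \<comment> \<open>The generating function is available at each point x; equality of values
    suffices because a field of characteristic 0 is infinite.\<close>
  have "poly (- pcompose (D n) [:0, -1:]) x
      = poly ((-1) ^ n * (\<Sum>k=0..n. of_nat (n choose k) * D k)) x" for x
  proof -
    \<comment> \<open>The extra factor t shifts the index, and being odd it supplies the minus sign
      under t -> -t. It also makes the constant coefficient vanish, matching
      \<open>D 0 = 0\<close>.\<close>
    define G where "G y = fps_X * (fps_X * fps_exp y / (fps_exp 1 - 1))" for y :: 'a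
    have G_nth: "fps_nth (G y) k = poly (D k) y / fact k" for y k
      unfolding G_def bernpoly_generating_function
      by (cases k) (simp_all add: D_def field_simps del: of_nat_Suc)
    have "G (- x) oo (- fps_X) = - (G x * fps_exp 1)"
      unfolding G_def by (simp add: fps_compose_mult_distrib bernpoly_gf_reflect mult.assoc)
    then have "fps_nth (G (- x) oo (- fps_X)) n = - fps_nth (G x * fps_exp 1) n"
      by simp
    then have "(-1) ^ n * (poly (D n) (- x) / fact n)
        = - (\<Sum>k=0..n. poly (D k) x / fact k * (1 / fact (n - k)))"
      by (simp add: fps_compose_uminus' fps_mult_nth G_nth)
    then have "fact n * ((-1) ^ n * (poly (D n) (- x) / fact n))
        = fact n * - (\<Sum>k=0..n. poly (D k) x / fact k * (1 / fact (n - k)))"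
      by (rule arg_cong)
    then have "(-1) ^ n * poly (D n) (- x)
        = - (\<Sum>k=0..n. of_nat (n choose k) * poly (D k) x)"
      by (simp add: sum_distrib_left binomial_fact ac_simps)
    then have "(-1) ^ n * ((-1) ^ n * poly (D n) (- x))
        = (-1) ^ n * - (\<Sum>k=0..n. of_nat (n choose k) * poly (D k) x)"
      by (rule arg_cong)
    then show ?thesis
      by (simp add: poly_pcompose poly_sum flip: mult.assoc power_mult_distrib)
  qed
  then show ?thesis
    by (intro poly_eq_poly_eq_iff[THEN iffD1] ext)
qed

theorem theorem1p6:
  fixes q m n :: nat
  assumes "m + n > 0"
  shows "(\<Sum>j=0..m+q. of_nat ((m+q) choose j) * of_nat (n+q+j) * bernpoly (n+q+j-1))
    = - ((-1) ^ (m+n) *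
        (\<Sum>k=0..n+q. of_nat ((n+q) choose k) * of_nat (m+q+k) *
           pcompose (bernpoly (m+q+k-1)) [:0, -1:]) :: 'a::field_char_0 poly)"
proof -
  define D :: "nat \<Rightarrow> 'a poly" where "D i = of_nat i * bernpoly (i - 1)" for i
  define R where "R i = pcompose (D i) [:0, -1:]" for i
  \<comment> \<open>Reciprocity for the sequences \<open>D\<close> and \<open>- R\<close>, with a =
    m+q and b = n+q; the exponent m+n+2q has the parity of m+n.\<close>
  have "(\<Sum>j=0..m+q. of_nat ((m+q) choose j) * D (n+q+j))
      = (-1) ^ ((m+q) + (n+q)) * (\<Sum>k=0..n+q. of_nat ((n+q) choose k) * - R (m+q+k))"
    unfolding R_def D_def
    by (intro binomial_transform_reciprocity bernpoly_reflect)
  moreover have "(-1) ^ ((m+q) + (n+q)) = ((-1) ^ (m+n) :: 'a poly)"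
    by (simp add: power_add ac_simps flip: power_mult_distrib mult.assoc)
  moreover have "R i = of_nat i * pcompose (bernpoly (i - 1)) [:0, -1:]" for i
    by (simp add: R_def D_def pcompose_smult of_nat_poly)
  ultimately show ?thesis
    by (simp add: D_def sum_negf mult.assoc)
qed

end
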